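(* Let $n \geq 2$ and let $\mathbb{F}_q$ be a finite field. The special unit-digraph on $\operatorname{Mat}_n(\mathbb{F}_q)$ is connected and has diameter $2$. It can be regarded as a simple undirected regular graph (i.e. its connection set $\operatorname{SL}_n(\mathbb{F}_q)$ satisfies $-\operatorname{SL}_n(\mathbb{F}_q)=\operatorname{SL}_n(\mathbb{F}_q)$) if and only if $n$ is even or $\operatorname{char}(\mathbb{F}_q) = 2$. Its adjacency matrix has at most $n+q-1$ distinct eigenvalues.
   Context: The special unit-digraph on $\operatorname{Mat}_n(\mathbb{F}_q)$ is the Cayley digraph $\operatorname{Cay}(\operatorname{Mat}_n(\mathbb{F}_q), \operatorname{SL}_n(\mathbb{F}_q))$: vertex set $\operatorname{Mat}_n(\mathbb{F}_q)$, with a directed edge from $A$ to $B$ iff $\det(B - A) = 1$. *)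

theory Defs
  imports "HOL-Analysis.Analysis"
begin

text \<open>Matrices Mat_n(F_q) are rendered as 'a^'n^'n with 'a a finite field and n = CARD('n).\<close>

definition SL :: "('a::comm_ring_1 ^'n::finite^'n) set" where
  "SL = {M. det M = 1}"

text \<open>Edge relation of the special unit-digraph Cay(Mat_n(F_q), SL_n(F_q)): A \<rightarrow> B iff det(B - A) = 1.\<close>
definition sud_edges :: "(('a::comm_ring_1 ^'n::finite^'n) \<times> ('a^'n^'n)) set" where
  "sud_edges = {(A, B). det (B - A) = 1}"

text \<open>Directed distance: least length of a directed walk from A to B.\<close>
definition sud_dist :: "('a::comm_ring_1 ^'n::finite^'n) \<Rightarrow> ('a^'n^'n) \<Rightarrow> nat" where
  "sud_dist A B = (LEAST k. (A, B) \<in> sud_edges ^^ k)"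

definition sud_strongly_connected :: "'a::comm_ring_1 itself \<Rightarrow> 'n::finite itself \<Rightarrow> bool" where
  "sud_strongly_connected _ _ \<longleftrightarrow> (\<forall>A B :: 'a^'n^'n. (A, B) \<in> sud_edges\<^sup>*)"

definition sud_diameter :: "'a::{comm_ring_1,finite} itself \<Rightarrow> 'n::finite itself \<Rightarrow> nat" where
  "sud_diameter _ _ = Max {sud_dist (A :: 'a^'n^'n) B | A B. True}"

text \<open>Adjacency matrix over the complex numbers, rows/columns indexed by the vertices.\<close>
definition sud_adj :: "complex ^ ('a::{comm_ring_1,finite} ^'n::finite^'n) ^ ('a^'n^'n)" where
  "sud_adj = (\<chi> A B. if (A, B) \<in> sud_edges then 1 else 0)"

definition is_eigenvalue :: "complex ^'m::finite^'m \<Rightarrow> complex \<Rightarrow> bool" where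
  "is_eigenvalue M c \<longleftrightarrow> (\<exists>v. v \<noteq> 0 \<and> M *v v = c *s v)"

end

theory Submission
  imports Defs "HOL-Computational_Algebra.Polynomial"
begin

text \<open>A walk A \<rightarrow> C \<rightarrow> B of length 2 exists iff B - A is a sum of two matrices of
  determinant 1. Under multiplication by SL_n on both sides every nonzero matrix is equivalent to
  E_r = diag(1, \<dots>, 1, 0, \<dots>, 0) of rank 0 < r < n or to diag(1, \<dots>, 1, c) with c \<noteq> 0, and for
  each class an explicit representative splits into a lower and an upper triangular matrix of
  determinant 1 by splitting its diagonal. A nonzero singular matrix is not an edge, so the
  diameter is exactly 2.

  The (A, B) entry of every power of the adjacency matrix depends only on the class of B - A,
  and there are n + q - 1 classes. Hence the first n + q powers are linearly dependent, and every
  eigenvalue is a root of the resulting polynomial of degree at most n + q - 1.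

  Finally det (- M) = (-1)^n det M, so -SL_n = SL_n iff (-1)^n = 1.\<close>

section \<open>An enumeration of the index type\<close>

text \<open>A fixed order on the index type, through which lower and upper triangular matrices and
  the first r coordinates make sense.\<close>
definition idx :: "'n::finite \<Rightarrow> nat" where
  "idx = (SOME f. bij_betw f (UNIV::'n set) {..<CARD('n)})"

lemma bij_betw_idx: "bij_betw (idx::'n::finite \<Rightarrow> nat) UNIV {..<CARD('n)}"
proof -
  have "\<exists>f. bij_betw f (UNIV::'n set) {..<CARD('n)}"
    using ex_bij_betw_finite_nat[of "UNIV::'n set"] by (auto simp: atLeast0LessThan)
  then show ?thesis
    unfolding idx_def by (rule someI_ex)
qed

lemma idx_eq_iff [simp]: "idx i = idx j \<longleftrightarrow> i = j"
  using bij_betw_idx unfolding bij_betw_def inj_on_def by auto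

lemma idx_less_card [simp]: "idx (i::'n::finite) < CARD('n)"
  using bij_betw_idx unfolding bij_betw_def by auto

lemma ex_idx_eq: "k < CARD('n) \<Longrightarrow> \<exists>i::'n::finite. idx i = k"
  using bij_betw_idx unfolding bij_betw_def by (metis image_iff lessThan_iff)

lemma card_idx_less: "card {i::'n::finite. idx i < r} = min r CARD('n)"
proof -
  have "idx ` {i::'n. idx i < r} = {..<min r CARD('n)}"
    by (auto simp: image_iff) (metis ex_idx_eq)
  moreover have "inj_on idx {i::'n. idx i < r}"
    by (simp add: inj_on_def)
  ultimately show ?thesis
    using card_image by fastforce
qed

lemma card_idx_not_less [simp]: "card {i::'n::finite. \<not> idx i < r} = CARD('n) - r"
proof -
  have "{i::'n. \<not> idx i < r} = UNIV - {i. idx i < r}"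
    by auto
  then show ?thesis
    by (simp add: card_Diff_subset card_idx_less)
qed

lemma permutation_raises_idx:
  fixes p :: "'n::finite \<Rightarrow> 'n"
  assumes p: "p permutes UNIV" and "p \<noteq> id"
  shows "\<exists>i. idx i < idx (p i)"
proof (rule ccontr)
  assume "\<not> ?thesis"
  then have le: "\<And>i. idx (p i) \<le> idx i"
    by (simp add: not_less)
  have "(\<Sum>i\<in>UNIV. idx (p i)) = (\<Sum>i\<in>(UNIV::'n set). idx i)"
    using sum.permute[OF p, of idx] by (simp add: comp_def)
  then have "\<forall>i. idx (p i) = idx i"
    using sum_mono_inv[where f="\<lambda>i. idx (p i)" and g=idx and I=UNIV] le by auto
  with \<open>p \<noteq> id\<close> show False
    by (auto simp: fun_eq_iff)
qed

definition idx_succ :: "'n::finite \<Rightarrow> 'n" where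
  "idx_succ i = (THE j. idx j = Suc (idx i) mod CARD('n))"

lemma idx_idx_succ: "idx (idx_succ (i::'n::finite)) = Suc (idx i) mod CARD('n)"
proof -
  have "\<exists>!j::'n. idx j = Suc (idx i) mod CARD('n)"
    using ex_idx_eq[of "Suc (idx i) mod CARD('n)"] by (metis idx_eq_iff mod_less_divisor zero_less_card_finite)
  then show ?thesis
    unfolding idx_succ_def by (rule theI')
qed

lemma idx_succ_permutes: "idx_succ permutes (UNIV::'n::finite set)"
proof -
  have "inj (idx_succ::'n \<Rightarrow> 'n)"
  proof (rule injI)
    fix i j :: 'n
    assume "idx_succ i = idx_succ j"
    then have "Suc (idx i) mod CARD('n) = Suc (idx j) mod CARD('n)"
      by (metis idx_idx_succ)
    then show "i = j"
      using idx_less_card[of i] idx_less_card[of j] by (auto simp: mod_Suc simp flip: idx_eq_iff split: if_splits)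
  qed
  then show ?thesis
    by (intro bij_imp_permutes) (simp_all add: finite_UNIV_inj_surj bij_betw_def)
qed

lemma idx_succ_neq:
  assumes "CARD('n::finite) \<ge> 2"
  shows "idx_succ (i::'n) \<noteq> i"
  using assms idx_idx_succ[of i] idx_less_card[of i] by (auto simp: mod_Suc split: if_splits)

section \<open>Special matrices\<close>

lemma det_idx_lower_triangular:
  fixes A :: "'a::comm_ring_1^'n::finite^'n"
  assumes "\<And>i j. idx i < idx j \<Longrightarrow> A$i$j = 0"
  shows "det A = (\<Prod>i\<in>UNIV. A$i$i)"
proof -
  have "of_int (sign p) * (\<Prod>i\<in>UNIV. A$i$p i) = 0" if "p permutes UNIV" "p \<noteq> id" for p
    using permutation_raises_idx[OF that] assms by (metis UNIV_I finite prod_zero mult_zero_right)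
  then have "det A = (\<Sum>p\<in>{id}. of_int (sign p) * (\<Prod>i\<in>UNIV. A$i$p i))"
    unfolding det_def by (intro sum.mono_neutral_cong_right) (auto simp: permutes_id)
  then show ?thesis
    by (simp add: sign_id)
qed

lemma det_idx_upper_triangular:
  fixes A :: "'a::comm_ring_1^'n::finite^'n"
  assumes "\<And>i j. idx j < idx i \<Longrightarrow> A$i$j = 0"
  shows "det A = (\<Prod>i\<in>UNIV. A$i$i)"
  using det_idx_lower_triangular[of "transpose A"] assms det_transpose[of A]
  by (simp add: transpose_def)

definition diag_mat :: "('n::finite \<Rightarrow> 'a::zero) \<Rightarrow> 'a^'n^'n" where
  "diag_mat g = (\<chi> i j. if i = j then g i else 0)"

definition monomial_mat :: "('n::finite \<Rightarrow> 'n) \<Rightarrow> ('n \<Rightarrow> 'a::zero) \<Rightarrow> 'a^'n^'n" where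
  "monomial_mat p g = (\<chi> i j. if j = p i then g j else 0)"

text \<open>The matrix E_r = diag(1, \<dots>, 1, 0, \<dots>, 0) with r ones.\<close>
definition partial_id :: "nat \<Rightarrow> 'a::{zero,one}^'n::finite^'n" where
  "partial_id r = diag_mat (\<lambda>i. if idx i < r then 1 else 0)"

lemma diag_mat_nth: "diag_mat g $ i $ j = (if i = j then g i else 0)"
  by (simp add: diag_mat_def)

lemma monomial_mat_nth: "monomial_mat p g $ i $ j = (if j = p i then g j else 0)"
  by (simp add: monomial_mat_def)

lemma partial_id_nth: "partial_id r $ i $ j = (if i = j \<and> idx i < r then 1 else 0)"
  by (simp add: partial_id_def diag_mat_nth)

lemma det_diag_mat: "det (diag_mat g :: 'a::comm_ring_1^'n::finite^'n) = (\<Prod>i\<in>UNIV. g i)"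
  by (subst det_diagonal) (auto simp: diag_mat_nth)

lemma det_monomial_mat:
  assumes "p permutes (UNIV::'n::finite set)"
  shows "det (monomial_mat p g :: 'a::comm_ring_1^'n^'n) = of_int (sign p) * (\<Prod>i\<in>UNIV. g i)"
proof -
  have "monomial_mat p g = (\<chi> i. diag_mat g $ p i)"
    by (auto simp: vec_eq_iff monomial_mat_nth diag_mat_nth)
  then show ?thesis
    using det_permute_rows[OF assms, of "diag_mat g"] by (simp add: det_diag_mat)
qed

lemma sign_times_sign: "(of_int (sign p) :: 'a::comm_ring_1) * of_int (sign p) = 1"
  by (metis of_int_1 of_int_mult sign_idempotent)

lemma det_monomial_mat_ones_nonzero:
  assumes "p permutes (UNIV::'n::finite set)"
  shows "det (monomial_mat p (\<lambda>_. 1) :: 'a::field^'n^'n) \<noteq> 0"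
  using det_monomial_mat[OF assms, of "\<lambda>_. 1::'a"] sign_times_sign[of p, where 'a='a] by force

lemma matrix_mul_diag_mat_nth: "(X ** diag_mat h) $ i $ j = X $ i $ j * h j"
  by (simp add: matrix_matrix_mult_def diag_mat_nth if_distrib[of "\<lambda>x. y * x" for y] cong: if_cong)

lemma diag_mat_mul_nth: "(diag_mat h ** X) $ i $ j = h i * X $ i $ j"
  by (simp add: matrix_matrix_mult_def diag_mat_nth if_distrib[of "\<lambda>x. x * y" for y] cong: if_cong)

lemma monomial_mat_mul_nth: "(monomial_mat p g ** X) $ i $ j = g (p i) * X $ (p i) $ j"
  by (simp add: matrix_matrix_mult_def monomial_mat_nth if_distrib[of "\<lambda>x. x * y" for y] cong: if_cong)

lemma partial_id_full: "partial_id CARD('n) = (mat 1 :: 'a::{zero,one}^'n::finite^'n)"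
  by (simp add: vec_eq_iff partial_id_nth mat_def)

lemma partial_id_0: "partial_id 0 = (0 :: 'a::{zero,one}^'n::finite^'n)"
  by (simp add: vec_eq_iff partial_id_nth)

lemma matrix_add_rdistrib: "(B + C) ** A = B ** A + C ** (A :: 'a::semiring_1^'n::finite^'m)"
  by (vector matrix_matrix_mult_def sum.distrib[symmetric] distrib_right)

lemma matrix_diff_ldistrib: "A ** (B - C) = A ** B - A ** (C :: 'a::ring_1^'n::finite^'m)"
  by (metis add_diff_cancel diff_add_cancel matrix_add_ldistrib)

lemma matrix_diff_rdistrib: "(B - C) ** A = B ** A - C ** (A :: 'a::ring_1^'n::finite^'m)"
  by (metis add_diff_cancel diff_add_cancel matrix_add_rdistrib)

lemma matrix_mul_sandwich_cancel:
  assumes "P' ** P = mat 1" "Q ** Q' = mat 1"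
  shows "P' ** (P ** X ** Q) ** Q' = (X :: 'a::semiring_1^'n::finite^'n)"
proof -
  have "P' ** (P ** X ** Q) ** Q' = (P' ** P) ** X ** (Q ** Q')"
    by (simp add: matrix_mul_assoc)
  then show ?thesis
    using assms by simp
qed

lemma inverse_matrix_exists:
  fixes A :: "'a::field^'n::finite^'n"
  assumes "det A \<noteq> 0"
  obtains B where "A ** B = mat 1" "B ** A = mat 1" "det A * det B = 1"
proof -
  obtain B where "A ** B = mat 1" "B ** A = mat 1"
    using assms invertible_det_nz[of A] unfolding invertible_def by blast
  moreover from this have "det A * det B = 1"
    by (metis det_I det_mul)
  ultimately show thesis
    by (rule that)
qed

lemma det_nonzero_if_columns_span:
  fixes A :: "'a::field^'n::finite^'n"
  assumes "vec.span (columns A) = UNIV"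
  shows "det A \<noteq> 0"
  using assms matrix_right_invertible_span_columns[of A] invertible_right_inverse[of A]
    invertible_det_nz[of A] by blast

section \<open>Rank normal form\<close>

lemma span_Int_span_disjoint:
  fixes B :: "('a::field^'n::finite) set"
  assumes "vec.independent B" "C \<subseteq> B" "D \<subseteq> B" "C \<inter> D = {}"
  shows "vec.span C \<inter> vec.span D = {0}"
proof -
  have "finite B"
    using assms(1) vec.finiteI_independent by blast
  then have "finite C" "finite D"
    using assms(2,3) finite_subset by auto
  have "x = 0" if xC: "x \<in> vec.span C" and xD: "x \<in> vec.span D" for x
  proof -
    obtain u where u: "x = (\<Sum>v\<in>C. u v *s v)"
      using xC unfolding vec.span_finite[OF \<open>finite C\<close>] by blast
    obtain w where w: "x = (\<Sum>v\<in>D. w v *s v)"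
      using xD unfolding vec.span_finite[OF \<open>finite D\<close>] by blast
    define c where "c v = (if v \<in> C then u v else - w v)" for v
    have "(\<Sum>v\<in>C \<union> D. c v *s v) = (\<Sum>v\<in>C. c v *s v) + (\<Sum>v\<in>D. c v *s v)"
      by (rule sum.union_disjoint[OF \<open>finite C\<close> \<open>finite D\<close> assms(4)])
    also have "(\<Sum>v\<in>C. c v *s v) = x"
      using u by (simp add: c_def)
    also have "(\<Sum>v\<in>D. c v *s v) = (\<Sum>v\<in>D. - (w v *s v))"
      by (rule sum.cong) (use assms(4) in \<open>auto simp: c_def vec.scale_minus_left\<close>)
    also have "\<dots> = - x"
      using w by (simp add: sum_negf)
    finally have "(\<Sum>v\<in>C \<union> D. c v *s v) = 0"
      by simp
    then have "\<forall>v\<in>C \<union> D. c v = 0"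
      using vec.independent_explicit assms vec.independent_mono[of B "C \<union> D"] by blast
    then have "\<forall>v\<in>C. u v = 0"
      unfolding c_def by (metis UnI1)
    then show "x = 0"
      using u by simp
  qed
  then show ?thesis
    by (auto simp: vec.span_zero)
qed

lemma card_basis_vec:
  fixes B :: "('a::field^'n::finite) set"
  assumes "vec.independent B" "vec.span B = UNIV"
  shows "card B = CARD('n)"
  using vec.dim_span_eq_card_independent[OF assms(1)] assms(2) vec_dim_card[where 'a='a and 'n='n]
  by simp

lemma ex_kernel_basis_and_complement:
  fixes M :: "'a::field^'n::finite^'n"
  obtains K C :: "('a^'n) set" where "K \<subseteq> {v. M *v v = 0}" "vec.span (C \<union> K) = UNIV"
    "finite C" "finite K" "card C + card K = CARD('n)"
    "inj_on ((*v) M) C" "vec.independent ((*v) M ` C)"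
proof -
  have lin: "Vector_Spaces.linear (*s) (*s) ((*v) M)"
    by simp
  obtain K where K: "K \<subseteq> {v. M *v v = 0}" "vec.independent K" "{v. M *v v = 0} \<subseteq> vec.span K"
    by (rule vec.basis_exists)
  define B where "B = vec.extend_basis K"
  define C where "C = B - K"
  have B: "K \<subseteq> B" "vec.independent B" "vec.span B = UNIV"
    unfolding B_def using K(2) by (simp_all add: vec.extend_basis_superset vec.independent_extend_basis)
  have "finite B"
    by (rule vec.finiteI_independent[OF B(2)])
  then have fin: "finite C" "finite K"
    using B(1) by (auto simp: C_def intro: finite_subset)
  have "card C + card K = CARD('n)"
    using fin card_basis_vec[OF B(2,3)] card_mono[OF \<open>finite B\<close> B(1)]
    by (simp add: C_def card_Diff_subset[OF _ B(1)])
  have "vec.span (C \<union> K) = UNIV"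
    using B(1,3) by (simp add: C_def Un_absorb2)
  have "inj_on ((*v) M) (vec.span C)"
  proof (subst vec.linear_inj_on_iff_eq_0[OF lin vec.subspace_span], intro ballI impI)
    fix x
    assume "x \<in> vec.span C" "M *v x = 0"
    then have "x \<in> vec.span C \<inter> vec.span K"
      using K(3) by auto
    then show "x = 0"
      using span_Int_span_disjoint[OF B(2) _ B(1)] by (auto simp: C_def)
  qed
  then have "inj_on ((*v) M) C" "vec.independent ((*v) M ` C)"
    using vec.linear_independent_injective_image[OF lin] vec.independent_mono[OF B(2)]
      inj_on_subset[OF _ vec.span_superset] by (auto simp: C_def)
  then show thesis
    using that[OF K(1) \<open>vec.span (C \<union> K) = UNIV\<close> fin \<open>card C + card K = CARD('n)\<close>] by blast
qed

lemma ex_enumeration_idx_split: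
  assumes "finite S" "finite T" "card S = r" "card T = CARD('n) - r" "r \<le> CARD('n)"
  obtains f :: "'n::finite \<Rightarrow> 'b" where "f ` {i. idx i < r} = S" "f ` {i. \<not> idx i < r} = T"
proof -
  obtain g where "bij_betw g {i::'n. idx i < r} S"
    using finite_same_card_bij[of "{i::'n. idx i < r}" S] assms by (auto simp: card_idx_less)
  moreover obtain h where "bij_betw h {i::'n. \<not> idx i < r} T"
    using finite_same_card_bij[of "{i::'n. \<not> idx i < r}" T] assms by auto
  ultimately show thesis
    using that[of "\<lambda>i. if idx i < r then g i else h i"]
    by (auto simp: bij_betw_def image_def)
qed

text \<open>The \<beta> i form a basis whose vectors beyond the first r span the kernel, and the \<gamma> i
  extend the images of the first r of them to a basis: they are the columns of Q and P in
  M Q = P E_r.\<close>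
lemma ex_partial_id_columns:
  fixes M :: "'a::field^'n::finite^'n"
  obtains r and \<beta> \<gamma> :: "'n \<Rightarrow> 'a^'n" where "r \<le> CARD('n)"
    "vec.span (range \<beta>) = UNIV" "vec.span (range \<gamma>) = UNIV"
    "\<And>i. M *v \<beta> i = (if idx i < r then \<gamma> i else 0)"
proof -
  obtain K C where K: "K \<subseteq> {v. M *v v = 0}" and span: "vec.span (C \<union> K) = UNIV"
    and fin: "finite C" "finite K" and card: "card C + card K = CARD('n)"
    and inj: "inj_on ((*v) M) C" and indep: "vec.independent ((*v) M ` C)"
    by (rule ex_kernel_basis_and_complement)
  define r where "r = card C"
  define G where "G = vec.extend_basis ((*v) M ` C)"
  have G: "(*v) M ` C \<subseteq> G" "vec.independent G" "vec.span G = UNIV"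
    unfolding G_def using indep by (simp_all add: vec.extend_basis_superset vec.independent_extend_basis)
  have "finite G"
    by (rule vec.finiteI_independent[OF G(2)])
  have "card (G - (*v) M ` C) = CARD('n) - r"
    using card_Diff_subset[OF finite_imageI[OF fin(1)] G(1)] card_basis_vec[OF G(2,3)]
      card_image[OF inj] by (simp add: r_def)
  have "r \<le> CARD('n)" "card C = r" "card K = CARD('n) - r" "card ((*v) M ` C) = r"
    using card card_image[OF inj] by (simp_all add: r_def)
  obtain \<beta> :: "'n \<Rightarrow> 'a^'n" where \<beta>: "\<beta> ` {i. idx i < r} = C" "\<beta> ` {i. \<not> idx i < r} = K"
    by (rule ex_enumeration_idx_split[OF fin \<open>card C = r\<close> \<open>card K = CARD('n) - r\<close> \<open>r \<le> CARD('n)\<close>])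
  obtain \<delta> :: "'n \<Rightarrow> 'a^'n" where "\<delta> ` {i. idx i < r} = (*v) M ` C"
    and \<delta>: "\<delta> ` {i. \<not> idx i < r} = G - (*v) M ` C"
    by (rule ex_enumeration_idx_split[OF finite_imageI[OF fin(1)] finite_Diff[OF \<open>finite G\<close>]
          \<open>card ((*v) M ` C) = r\<close> \<open>card (G - (*v) M ` C) = CARD('n) - r\<close> \<open>r \<le> CARD('n)\<close>])
  define \<gamma> where "\<gamma> i = (if idx i < r then M *v \<beta> i else \<delta> i)" for i
  have "C \<union> K \<subseteq> range \<beta>"
    using \<beta> by auto
  then have "vec.span (range \<beta>) = UNIV"
    using vec.span_mono span by (metis top.extremum_uniqueI)
  moreover have "G \<subseteq> range \<gamma>"
  proof -
    have "G - (*v) M ` C \<subseteq> range \<gamma>"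
      using \<delta> by (auto simp: \<gamma>_def)
    then have "G \<subseteq> (*v) M ` C \<union> range \<gamma>"
      by (simp add: Diff_subset_conv)
    also have "(*v) M ` C \<subseteq> range \<gamma>"
      using \<beta>(1) by (auto simp: \<gamma>_def)
    then have "(*v) M ` C \<union> range \<gamma> = range \<gamma>"
      by (rule Un_absorb1)
    finally show ?thesis .
  qed
  then have "vec.span (range \<gamma>) = UNIV"
    using vec.span_mono G(3) by (metis top.extremum_uniqueI)
  moreover have "M *v \<beta> i = (if idx i < r then \<gamma> i else 0)" for i
    using \<beta>(2) K by (auto simp: \<gamma>_def)
  ultimately show thesis
    by (rule that[OF \<open>r \<le> CARD('n)\<close>])
qed

lemma rank_normal_form:
  fixes M :: "'a::field^'n::finite^'n"
  obtains P Q r where "det P \<noteq> 0" "det Q \<noteq> 0" "r \<le> CARD('n)" "M = P ** partial_id r ** Q"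
proof -
  obtain r and \<beta> \<gamma> :: "'n \<Rightarrow> 'a^'n" where "r \<le> CARD('n)"
    and span: "vec.span (range \<beta>) = UNIV" "vec.span (range \<gamma>) = UNIV"
    and M\<beta>: "\<And>i. M *v \<beta> i = (if idx i < r then \<gamma> i else 0)"
    using ex_partial_id_columns[of M] by blast
  define B C :: "'a^'n^'n" where "B = transpose (\<chi> i. \<beta> i)" and "C = transpose (\<chi> i. \<gamma> i)"
  have "columns B = range \<beta>" "columns C = range \<gamma>"
    by (auto simp: B_def C_def rows_def row_def)
  then have "det B \<noteq> 0" "det C \<noteq> 0"
    using span det_nonzero_if_columns_span[of B] det_nonzero_if_columns_span[of C] by auto
  have "M ** B = C ** partial_id r"
  proof -
    have "(M ** B) $ k $ i = (M *v \<beta> i) $ k" for k i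
      by (simp add: matrix_matrix_mult_def matrix_vector_mult_def B_def transpose_def)
    then show ?thesis
      by (simp add: vec_eq_iff M\<beta> partial_id_def matrix_mul_diag_mat_nth C_def transpose_def)
  qed
  obtain B' where "B ** B' = mat 1" "det B * det B' = 1"
    using inverse_matrix_exists[OF \<open>det B \<noteq> 0\<close>] by blast
  have "M = M ** B ** B'"
    using \<open>B ** B' = mat 1\<close> by (simp add: matrix_mul_assoc[symmetric])
  then have "M = C ** partial_id r ** B'"
    using \<open>M ** B = C ** partial_id r\<close> by simp
  moreover have "det B' \<noteq> 0"
    using \<open>det B * det B' = 1\<close> by auto
  ultimately show thesis
    using that \<open>det C \<noteq> 0\<close> \<open>r \<le> CARD('n)\<close> by blast
qed

section \<open>Equivalence under SL(n) acting on both sides\<close>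

definition SL_equiv :: "'a::comm_ring_1^'n::finite^'n \<Rightarrow> 'a^'n^'n \<Rightarrow> bool" where
  "SL_equiv M N \<longleftrightarrow> (\<exists>P\<in>SL. \<exists>Q\<in>SL. M = P ** N ** Q)"

lemma SL_equiv_det: "SL_equiv M N \<Longrightarrow> det M = det N"
  unfolding SL_equiv_def SL_def by (auto simp: det_mul)

lemma SL_equiv_trans:
  assumes "SL_equiv M N" "SL_equiv N L"
  shows "SL_equiv M L"
proof -
  obtain P Q P' Q' where "P \<in> SL" "Q \<in> SL" "M = P ** N ** Q" "P' \<in> SL" "Q' \<in> SL" "N = P' ** L ** Q'"
    using assms unfolding SL_equiv_def by blast
  then have "M = (P ** P') ** L ** (Q' ** Q)" "P ** P' \<in> SL" "Q' ** Q \<in> SL"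
    by (simp_all add: matrix_mul_assoc SL_def det_mul)
  then show ?thesis
    unfolding SL_equiv_def by blast
qed

lemma inverse_SL_exists:
  fixes P :: "'a::field^'n::finite^'n"
  assumes "P \<in> SL"
  obtains P' where "P' \<in> SL" "P ** P' = mat 1" "P' ** P = mat 1"
proof -
  obtain P' where "P ** P' = mat 1" "P' ** P = mat 1" "det P * det P' = 1"
    using assms inverse_matrix_exists[of P] by (auto simp: SL_def)
  moreover from this have "P' \<in> SL"
    using assms by (simp add: SL_def)
  ultimately show thesis
    using that by blast
qed

lemma SL_equiv_sym:
  fixes M N :: "'a::field^'n::finite^'n"
  assumes "SL_equiv M N"
  shows "SL_equiv N M"
proof -
  obtain P Q where "P \<in> SL" "Q \<in> SL" and M: "M = P ** N ** Q"
    using assms unfolding SL_equiv_def by blast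
  obtain P' where "P' \<in> SL" "P' ** P = mat 1"
    using inverse_SL_exists[OF \<open>P \<in> SL\<close>] by blast
  obtain Q' where "Q' \<in> SL" "Q ** Q' = mat 1"
    using inverse_SL_exists[OF \<open>Q \<in> SL\<close>] by blast
  have "N = P' ** M ** Q'"
    unfolding M using \<open>P' ** P = mat 1\<close> \<open>Q ** Q' = mat 1\<close> by (simp add: matrix_mul_sandwich_cancel)
  then show ?thesis
    unfolding SL_equiv_def using \<open>P' \<in> SL\<close> \<open>Q' \<in> SL\<close> by blast
qed

lemma SL_equiv_zero_iff:
  fixes M N :: "'a::field^'n::finite^'n"
  assumes "SL_equiv M N"
  shows "M = 0 \<longleftrightarrow> N = 0"
  using assms SL_equiv_sym[OF assms] unfolding SL_equiv_def by auto

lemma SL_equiv_if_det_eq: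
  fixes M N :: "'a::field^'n::finite^'n"
  assumes "det M = det N" "det N \<noteq> 0"
  shows "SL_equiv M N"
proof -
  obtain N' where "N ** N' = mat 1" "N' ** N = mat 1" "det N * det N' = 1"
    by (rule inverse_matrix_exists[OF assms(2)])
  then have "M = (M ** N') ** N ** mat 1" "M ** N' \<in> SL" "mat 1 \<in> SL"
    using assms(1) by (simp_all add: matrix_mul_assoc[symmetric] det_mul SL_def)
  then show ?thesis
    unfolding SL_equiv_def by blast
qed

definition corner_diag :: "'a::{zero,one} \<Rightarrow> 'a^'n::finite^'n" where
  "corner_diag c = diag_mat (\<lambda>i. if idx i = CARD('n) - 1 then c else 1)"

lemma det_corner_diag: "det (corner_diag c :: 'a::comm_ring_1^'n::finite^'n) = c"
proof -
  obtain i0 :: 'n where "idx i0 = CARD('n) - 1"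
    using ex_idx_eq[of "CARD('n) - 1", where 'n='n] by auto
  then have "(\<lambda>i::'n. if idx i = CARD('n) - 1 then c else 1) = (\<lambda>i. if i = i0 then c else 1)"
    by (metis idx_eq_iff)
  then show ?thesis
    by (simp add: corner_diag_def det_diag_mat prod.delta)
qed

lemma corner_diag_commutes_partial_id:
  assumes "r < CARD('n::finite)"
  shows "corner_diag c ** partial_id r = (partial_id r :: 'a::comm_ring_1^'n^'n)"
    and "partial_id r ** corner_diag c = (partial_id r :: 'a::comm_ring_1^'n^'n)"
proof -
  have "\<not> CARD('n) - 1 < r"
    using assms by linarith
  then show "corner_diag c ** partial_id r = (partial_id r :: 'a^'n^'n)"
    and "partial_id r ** corner_diag c = (partial_id r :: 'a^'n^'n)"
    by (simp_all add: vec_eq_iff corner_diag_def diag_mat_mul_nth matrix_mul_diag_mat_nth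
        partial_id_nth)
qed

text \<open>Below full rank, the determinants of P and Q can be absorbed into the corner entries,
  which the partial identity does not see.\<close>
lemma SL_equiv_partial_id:
  fixes P Q :: "'a::field^'n::finite^'n"
  assumes "det P \<noteq> 0" "det Q \<noteq> 0" "r < CARD('n)"
  shows "SL_equiv (P ** partial_id r ** Q) (partial_id r)"
proof -
  let ?P = "P ** corner_diag (inverse (det P))" and ?Q = "corner_diag (inverse (det Q)) ** Q"
  have "P ** partial_id r ** Q
      = P ** (corner_diag (inverse (det P)) ** partial_id r ** corner_diag (inverse (det Q))) ** Q"
    using assms(3) by (simp add: corner_diag_commutes_partial_id)
  also have "\<dots> = ?P ** partial_id r ** ?Q"
    by (simp add: matrix_mul_assoc)
  finally have "P ** partial_id r ** Q = ?P ** partial_id r ** ?Q" .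
  moreover have "?P \<in> SL" "?Q \<in> SL"
    using assms by (simp_all add: SL_def det_mul det_corner_diag)
  ultimately show ?thesis
    unfolding SL_equiv_def by blast
qed

lemma SL_equiv_representative:
  fixes M :: "'a::field^'n::finite^'n"
  shows "(\<exists>r < CARD('n). SL_equiv M (partial_id r)) \<or> (\<exists>c. c \<noteq> 0 \<and> SL_equiv M (corner_diag c))"
proof -
  obtain P Q r where PQ: "det P \<noteq> 0" "det Q \<noteq> 0" "r \<le> CARD('n)" "M = P ** partial_id r ** Q"
    by (rule rank_normal_form)
  show ?thesis
  proof (cases "r < CARD('n)")
    case True
    then show ?thesis
      using SL_equiv_partial_id[OF PQ(1,2) True] PQ(4) by blast
  next
    case False
    then have "det M \<noteq> 0"
      using PQ by (simp add: partial_id_full det_mul)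
    then show ?thesis
      using SL_equiv_if_det_eq[of M "corner_diag (det M)"] by (auto simp: det_corner_diag)
  qed
qed

section \<open>Sums of two matrices of determinant 1\<close>

definition SL_sum :: "'a::comm_ring_1^'n::finite^'n \<Rightarrow> bool" where
  "SL_sum N \<longleftrightarrow> (\<exists>S\<in>SL. \<exists>T\<in>SL. N = S + T)"

lemma SL_sum_if_diagonal_splits:
  fixes N :: "'a::comm_ring_1^'n::finite^'n"
  assumes "\<And>i. N$i$i = s i + t i" "(\<Prod>i\<in>UNIV. s i) = 1" "(\<Prod>i\<in>UNIV. t i) = 1"
  shows "SL_sum N"
proof -
  define S :: "'a^'n^'n" where
    "S = (\<chi> i j. if idx j < idx i then N$i$j else if i = j then s i else 0)"
  define T :: "'a^'n^'n" where
    "T = (\<chi> i j. if idx i < idx j then N$i$j else if i = j then t i else 0)"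
  have "det S = 1"
    using assms(2) by (subst det_idx_lower_triangular) (auto simp: S_def)
  moreover have "det T = 1"
    using assms(3) by (subst det_idx_upper_triangular) (auto simp: T_def)
  moreover have "N = S + T"
    using assms(1) by (auto simp: vec_eq_iff S_def T_def dest: not_less_iff_gr_or_eq[THEN iffD1])
  ultimately show ?thesis
    by (auto simp: SL_sum_def SL_def)
qed

lemma prod_if_minus_one:
  "finite A \<Longrightarrow> (\<Prod>i\<in>A. if i \<in> B then -1 else (1::'a::comm_ring_1)) = (-1) ^ card (A \<inter> B)"
proof (induction A rule: finite_induct)
  case (insert x A)
  then show ?case
    by (cases "x \<in> B") (simp_all add: Int_insert_left)
qed simp

lemma SL_sum_if_diagonal_zero:
  fixes N :: "'a::comm_ring_1^'n::finite^'n"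
  assumes "(2::'a) = 0" "\<And>i. N$i$i = 0"
  shows "SL_sum N"
  by (rule SL_sum_if_diagonal_splits[where s="\<lambda>_. 1" and t="\<lambda>_. 1"])
    (simp_all add: assms one_add_one)

lemma SL_sum_if_diagonal_two_or_zero:
  fixes N :: "'a::comm_ring_1^'n::finite^'n"
  assumes "\<And>i. N$i$i = (if i \<in> Z then 0 else 2)" "even (card Z)"
  shows "SL_sum N"
proof (rule SL_sum_if_diagonal_splits[where s="\<lambda>_. 1" and t="\<lambda>i. if i \<in> Z then -1 else 1"])
  show "(\<Prod>i\<in>UNIV. if i \<in> Z then -1 else 1) = (1::'a)"
    using assms(2) by (subst prod_if_minus_one) simp_all
qed (simp_all add: assms one_add_one)

text \<open>In characteristic 2 a fixed-point-free monomial matrix has zero diagonal; otherwise a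
  transposition of two indices gives a diagonal of 2s with two 0s.\<close>
lemma ex_SL_sum_with_det:
  fixes c :: "'a::field"
  assumes n: "CARD('n::finite) \<ge> 2"
  shows "\<exists>N::'a^'n^'n. det N = c \<and> SL_sum N"
proof (cases "(2::'a) = 0")
  case True
  obtain i0 :: 'n where "idx i0 = 0"
    using ex_idx_eq[of 0] n by auto
  define g where "g i = (if i = i0 then c * of_int (sign (idx_succ::'n \<Rightarrow> 'n)) else 1)" for i :: 'n
  let ?N = "monomial_mat idx_succ g :: 'a^'n^'n"
  have "det ?N = c"
    using sign_times_sign[of "idx_succ::'n \<Rightarrow> 'n", where 'a='a]
    by (simp add: det_monomial_mat[OF idx_succ_permutes] g_def prod.delta algebra_simps)
  moreover have "SL_sum ?N"
    using True idx_succ_neq[OF n, THEN not_sym] by (intro SL_sum_if_diagonal_zero) (simp_all add: monomial_mat_nth)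
  ultimately show ?thesis
    by blast
next
  case False
  obtain a b :: 'n where "idx a = 0" and "idx b = 1"
    using ex_idx_eq[of 0] ex_idx_eq[of 1] n by force
  then have "a \<noteq> b"
    by auto
  define g where
    "g i = (if i = a then - (c / 2 ^ (CARD('n) - 2)) else if i = b then 1 else (2::'a))" for i :: 'n
  let ?N = "monomial_mat (Transposition.transpose a b) g :: 'a^'n^'n"
  have "(\<Prod>i\<in>UNIV. g i) = g a * g b * (\<Prod>i\<in>UNIV - {a, b}. g i)"
    using \<open>a \<noteq> b\<close> prod.remove[of UNIV a g] prod.remove[of "UNIV - {a}" b g]
    by (simp add: Diff_insert2[of UNIV a "{b}"] mult.assoc)
  also have "(\<Prod>i\<in>UNIV - {a, b}. g i) = (\<Prod>i\<in>UNIV - {a, b}. 2)"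
    by (rule prod.cong) (auto simp: g_def)
  also have "\<dots> = 2 ^ (CARD('n) - 2)"
    using \<open>a \<noteq> b\<close> by (simp add: card_Diff_subset numeral_2_eq_2)
  finally have "(\<Prod>i\<in>UNIV. g i) = - c"
    using \<open>a \<noteq> b\<close> False by (simp add: g_def)
  then have "det ?N = c"
    using \<open>a \<noteq> b\<close> by (simp add: det_monomial_mat[OF permutes_swap_id] sign_swap_id)
  moreover have "SL_sum ?N"
    using \<open>a \<noteq> b\<close> by (intro SL_sum_if_diagonal_two_or_zero[where Z="{a, b}"])
      (auto simp: monomial_mat_nth g_def transpose_eq_iff)
  ultimately show ?thesis
    by blast
qed

text \<open>As above, with rank r in place of full rank: scaling the first r columns by 2 turns the
  diagonal into 2s and 0s; if there is an odd number of 0s, a transposition of the first and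
  the last index turns one more 2 into a 0.\<close>
lemma ex_SL_sum_SL_equiv_partial_id:
  assumes n: "CARD('n::finite) \<ge> 2" and "0 < r" "r < CARD('n)"
  shows "\<exists>N::'a::field^'n^'n. SL_equiv N (partial_id r) \<and> SL_sum N"
proof (cases "(2::'a) = 0")
  case True
  let ?A = "monomial_mat idx_succ (\<lambda>_. 1) :: 'a^'n^'n"
  have "SL_sum (?A ** partial_id r ** mat 1)"
    using True idx_succ_neq[OF n] by (intro SL_sum_if_diagonal_zero) (simp_all add: monomial_mat_mul_nth partial_id_nth)
  then show ?thesis
    using SL_equiv_partial_id[OF det_monomial_mat_ones_nonzero[OF idx_succ_permutes] _ \<open>r < CARD('n)\<close>]
    by (metis det_I one_neq_zero)
next
  case False
  define D :: "'a^'n^'n" where "D = diag_mat (\<lambda>i. if idx i < r then 2 else 1)"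
  have "det D \<noteq> 0"
    using False by (simp add: D_def det_diag_mat)
  show ?thesis
  proof (cases "even (CARD('n) - r)")
    case True
    have "SL_sum (mat 1 ** partial_id r ** D)"
      using True by (intro SL_sum_if_diagonal_two_or_zero[where Z="{i. \<not> idx i < r}"])
        (simp_all add: D_def matrix_mul_diag_mat_nth partial_id_nth)
    then show ?thesis
      using SL_equiv_partial_id[OF _ \<open>det D \<noteq> 0\<close> \<open>r < CARD('n)\<close>] by (metis det_I one_neq_zero)
  next
    case False
    obtain a b :: 'n where a: "idx a = CARD('n) - 1" and b: "idx b = 0"
      using ex_idx_eq[of "CARD('n) - 1"] ex_idx_eq[of 0] n by force
    then have "a \<noteq> b"
      using n by auto
    let ?A = "monomial_mat (Transposition.transpose a b) (\<lambda>_. 1) :: 'a^'n^'n"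
    have "card (insert b {i. \<not> idx i < r}) = Suc (CARD('n) - r)"
      using b \<open>0 < r\<close> by simp
    then have "SL_sum (?A ** partial_id r ** D)"
      using False \<open>a \<noteq> b\<close> a b \<open>r < CARD('n)\<close>
      by (intro SL_sum_if_diagonal_two_or_zero[where Z="insert b {i. \<not> idx i < r}"])
        (auto simp: D_def matrix_mul_diag_mat_nth monomial_mat_mul_nth partial_id_nth
          Transposition.transpose_def)
    then show ?thesis
      using SL_equiv_partial_id[OF det_monomial_mat_ones_nonzero[OF permutes_swap_id] \<open>det D \<noteq> 0\<close>
          \<open>r < CARD('n)\<close>] by blast
  qed
qed

lemma SL_sum_SL_equiv:
  assumes "SL_equiv M N" "SL_sum N"
  shows "SL_sum M"
proof -
  obtain P Q S T where "P \<in> SL" "Q \<in> SL" "M = P ** N ** Q" "S \<in> SL" "T \<in> SL" "N = S + T"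
    using assms unfolding SL_equiv_def SL_sum_def by blast
  then have "M = P ** S ** Q + P ** T ** Q" "P ** S ** Q \<in> SL" "P ** T ** Q \<in> SL"
    by (simp_all add: matrix_add_ldistrib matrix_add_rdistrib SL_def det_mul)
  then show ?thesis
    unfolding SL_sum_def by blast
qed

theorem SL_sum_if_nonzero:
  fixes M :: "'a::field^'n::finite^'n"
  assumes n: "CARD('n) \<ge> 2" and "M \<noteq> 0"
  shows "SL_sum M"
proof -
  consider r where "r < CARD('n)" "SL_equiv M (partial_id r)"
    | c where "c \<noteq> 0" "SL_equiv M (corner_diag c)"
    using SL_equiv_representative[of M] by blast
  then show ?thesis
  proof cases
    case (1 r)
    then have "partial_id r \<noteq> (0::'a^'n^'n)"
      using SL_equiv_zero_iff \<open>M \<noteq> 0\<close> by blast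
    then have "0 < r"
      by (cases r) (simp_all add: partial_id_0)
    then obtain N :: "'a^'n^'n" where "SL_equiv N (partial_id r)" "SL_sum N"
      using ex_SL_sum_SL_equiv_partial_id[OF n _ \<open>r < CARD('n)\<close>] by blast
    then show ?thesis
      using SL_equiv_trans[OF 1(2) SL_equiv_sym] SL_sum_SL_equiv by blast
  next
    case (2 c)
    then have "det M \<noteq> 0"
      using SL_equiv_det[OF 2(2)] by (simp add: det_corner_diag)
    obtain N :: "'a^'n^'n" where "det N = det M" "SL_sum N"
      using ex_SL_sum_with_det[OF n] by blast
    then show ?thesis
      using SL_equiv_if_det_eq[of M N] \<open>det M \<noteq> 0\<close> SL_sum_SL_equiv[of M N] by simp
  qed
qed

section \<open>Connectivity, diameter and symmetry\<close>

lemma sud_edges_iff: "(A, B) \<in> sud_edges \<longleftrightarrow> B - A \<in> SL"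
  by (simp add: sud_edges_def SL_def)

lemma sud_walk_2:
  fixes A B :: "'a::field^'n::finite^'n"
  assumes "CARD('n) \<ge> 2" "A \<noteq> B"
  shows "(A, B) \<in> sud_edges ^^ 2"
proof -
  obtain S T where "S \<in> SL" "T \<in> SL" "B - A = S + T"
    using SL_sum_if_nonzero[OF assms(1), of "B - A"] assms(2) by (auto simp: SL_sum_def)
  then have "(A, A + S) \<in> sud_edges" "(A + S, B) \<in> sud_edges"
    by (simp_all add: sud_edges_iff algebra_simps)
  then have "(A, B) \<in> sud_edges O sud_edges"
    by (rule relcompI)
  then show ?thesis
    by (simp add: numeral_2_eq_2)
qed

lemma sud_dist_le_2:
  fixes A B :: "'a::field^'n::finite^'n"
  assumes "CARD('n) \<ge> 2"
  shows "sud_dist A B \<le> 2"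
proof (cases "A = B")
  case True
  then have "(A, B) \<in> sud_edges ^^ 0"
    by simp
  then show ?thesis
    unfolding sud_dist_def by (metis Least_le le0 le_trans)
next
  case False
  show ?thesis
    unfolding sud_dist_def
    by (rule Least_le[where P="\<lambda>k. (A, B) \<in> sud_edges ^^ k", OF sud_walk_2[OF assms False]])
qed

lemma sud_dist_partial_id_1:
  assumes "CARD('n::finite) \<ge> 2"
  shows "sud_dist 0 (partial_id 1 :: 'a::field^'n^'n) = 2"
  unfolding sud_dist_def
proof (rule Least_equality)
  obtain i0 i1 :: 'n where "idx i0 = 0" "idx i1 = 1"
    using ex_idx_eq[of 0] ex_idx_eq[of 1] assms by force
  have "partial_id 1 $ i0 $ i0 = (1::'a)"
    using \<open>idx i0 = 0\<close> by (simp add: partial_id_nth)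
  then have "partial_id 1 \<noteq> (0 :: 'a^'n^'n)"
    by (metis zero_index zero_neq_one)
  have "(\<Prod>i::'n\<in>UNIV. if idx i < 1 then 1 else 0) = (0::'a)"
    by (rule prod_zero[OF finite], rule bexI[of _ i1]) (simp_all add: \<open>idx i1 = 1\<close>)
  then have "det (partial_id 1 :: 'a^'n^'n) = 0"
    by (simp add: partial_id_def det_diag_mat)
  show "(0, partial_id 1 :: 'a^'n^'n) \<in> sud_edges ^^ 2"
    using \<open>partial_id 1 \<noteq> 0\<close> by (intro sud_walk_2[OF assms]) simp
  show "2 \<le> k" if "(0, partial_id 1 :: 'a^'n^'n) \<in> sud_edges ^^ k" for k
  proof (rule ccontr)
    assume "\<not> 2 \<le> k"
    then have "k = 0 \<or> k = 1"
      by auto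
    with that show False
      using \<open>partial_id 1 \<noteq> 0\<close> \<open>det (partial_id 1) = 0\<close> by (auto simp: sud_edges_def)
  qed
qed

theorem sud_strongly_connected:
  assumes "CARD('n::finite) \<ge> 2"
  shows "sud_strongly_connected TYPE('a::field) TYPE('n)"
  unfolding sud_strongly_connected_def
proof (intro allI)
  fix A B :: "'a^'n^'n"
  show "(A, B) \<in> sud_edges\<^sup>*"
  proof (cases "A = B")
    case False
    show ?thesis
      using sud_walk_2[OF assms False] by (rule relpow_imp_rtrancl)
  qed simp
qed

theorem sud_diameter_eq_2:
  assumes "CARD('n::finite) \<ge> 2"
  shows "sud_diameter TYPE('a::{finite,field}) TYPE('n) = 2"
proof -
  let ?D = "{sud_dist (A :: 'a^'n^'n) B | A B. True}"
  have "?D = (\<lambda>(A, B). sud_dist (A :: 'a^'n^'n) B) ` UNIV"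
    by auto
  then have "finite ?D"
    by simp
  moreover have "2 \<in> ?D"
    using sud_dist_partial_id_1[OF assms] by (metis (mono_tags, lifting) CollectI)
  ultimately show ?thesis
    unfolding sud_diameter_def using sud_dist_le_2[OF assms] by (intro Max_eqI) auto
qed

lemma det_uminus: "det (- M :: 'a::comm_ring_1^'n::finite^'n) = (-1) ^ CARD('n) * det M"
proof -
  have "- M = diag_mat (\<lambda>_. -1) ** M"
    by (simp add: vec_eq_iff diag_mat_mul_nth)
  then show ?thesis
    by (simp add: det_mul det_diag_mat)
qed

lemma CHAR_eq_2_iff: "CHAR('a::ring_1) = 2 \<longleftrightarrow> (-1::'a) = 1"
proof -
  have "(-1::'a) = 1 \<longleftrightarrow> 1 = (-1::'a)"
    by (rule eq_commute)
  also have "\<dots> \<longleftrightarrow> of_nat 2 = (0::'a)"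
    by (simp only: eq_neg_iff_add_eq_0 of_nat_numeral one_add_one)
  finally have "(-1::'a) = 1 \<longleftrightarrow> of_nat 2 = (0::'a)" .
  moreover have "CHAR('a) = 2 \<longleftrightarrow> of_nat 2 = (0::'a)"
  proof
    assume "CHAR('a) = 2"
    then show "of_nat 2 = (0::'a)"
      using of_nat_CHAR[where 'a='a] by simp
  next
    assume "of_nat 2 = (0::'a)"
    moreover have "of_nat x \<noteq> (0::'a)" if "0 < x" "x < 2" for x
      using that by (simp add: numeral_2_eq_2 less_Suc_eq)
    ultimately show "CHAR('a) = 2"
      by (intro CHAR_eq_posI) simp_all
  qed
  ultimately show ?thesis
    by simp
qed

lemma uminus_SL_eq_SL_iff:
  "uminus ` (SL :: ('a::field^'n::finite^'n) set) = SL \<longleftrightarrow> even CARD('n) \<or> CHAR('a) = 2"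
proof -
  have "mat 1 \<in> (SL :: ('a^'n^'n) set)"
    by (simp add: SL_def)
  have "uminus ` (SL :: ('a^'n^'n) set) = SL \<longleftrightarrow> (-1::'a) ^ CARD('n) = 1"
  proof
    assume "uminus ` (SL :: ('a^'n^'n) set) = SL"
    then have "- mat 1 \<in> (SL :: ('a^'n^'n) set)"
      using imageI[OF \<open>mat 1 \<in> SL\<close>, of uminus] by simp
    then show "(-1::'a) ^ CARD('n) = 1"
      by (simp add: SL_def det_uminus)
  next
    assume "(-1::'a) ^ CARD('n) = 1"
    then have det: "- M \<in> SL \<longleftrightarrow> M \<in> SL" for M :: "'a^'n^'n"
      by (simp add: SL_def det_uminus)
    show "uminus ` (SL :: ('a^'n^'n) set) = SL"
    proof (intro set_eqI iffI)
      show "M \<in> SL" if "M \<in> uminus ` SL" for M :: "'a^'n^'n"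
        using that det by auto
      show "M \<in> uminus ` SL" if "M \<in> SL" for M :: "'a^'n^'n"
        using that det[of "- M"] by (intro rev_image_eqI[of "- M"]) simp_all
    qed
  qed
  also have "\<dots> \<longleftrightarrow> even CARD('n) \<or> (-1::'a) = 1"
  proof (cases "even CARD('n)")
    case False
    then have "(-1::'a) ^ CARD('n) = -1"
      by simp
    then show ?thesis
      using False by simp
  qed simp
  finally show ?thesis
    by (simp add: CHAR_eq_2_iff)
qed

section \<open>Eigenvalues and annihilating polynomials\<close>

definition matrix_power :: "'a::semiring_1^'n::finite^'n \<Rightarrow> nat \<Rightarrow> 'a^'n^'n" where
  "matrix_power A k = ((**) A ^^ k) (mat 1)"

lemma matrix_power_0 [simp]: "matrix_power A 0 = mat 1"
  by (simp add: matrix_power_def)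

lemma matrix_power_Suc [simp]: "matrix_power A (Suc k) = A ** matrix_power A k"
  by (simp add: matrix_power_def)

lemma matrix_power_eigenvector:
  fixes A :: "'a::comm_semiring_1^'n::finite^'n"
  assumes "A *v v = c *s v"
  shows "matrix_power A k *v v = c ^ k *s v"
proof (induction k)
  case (Suc k)
  have scale: "A *v (d *s x) = d *s (A *v x)" for d x
    by (simp add: vec_eq_iff matrix_vector_mult_def sum_distrib_left algebra_simps)
  have "matrix_power A (Suc k) *v v = A *v (c ^ k *s v)"
    by (simp add: matrix_vector_mul_assoc[symmetric] Suc)
  also have "\<dots> = c ^ Suc k *s v"
    by (simp add: scale assms vector_smult_assoc mult.commute)
  finally show ?case .
qed simp

lemma eigenvalue_root_of_annihilating_polynomial:
  fixes A :: "complex^'n::finite^'n"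
  assumes "\<And>i j. (\<Sum>k\<le>m. a k * matrix_power A k $ i $ j) = 0" and "is_eigenvalue A c"
  shows "(\<Sum>k\<le>m. a k * c ^ k) = 0"
proof -
  obtain v where "v \<noteq> 0" "A *v v = c *s v"
    using assms(2) by (auto simp: is_eigenvalue_def)
  then obtain i where "v $ i \<noteq> 0"
    by (auto simp: vec_eq_iff)
  have "0 = (\<Sum>j\<in>UNIV. (\<Sum>k\<le>m. a k * matrix_power A k $ i $ j) * v $ j)"
    by (simp add: assms(1))
  also have "\<dots> = (\<Sum>k\<le>m. a k * (matrix_power A k *v v) $ i)"
    by (simp add: matrix_vector_mult_def sum_distrib_left sum_distrib_right mult.assoc
        sum.swap[of _ UNIV])
  also have "\<dots> = (\<Sum>k\<le>m. a k * c ^ k) * v $ i"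
    using matrix_power_eigenvector[OF \<open>A *v v = c *s v\<close>]
    by (simp add: sum_distrib_right mult.assoc)
  finally show ?thesis
    using \<open>v $ i \<noteq> 0\<close> by simp
qed

lemma card_eigenvalues_le_annihilator_degree:
  fixes A :: "complex^'n::finite^'n"
  assumes "\<And>i j. (\<Sum>k\<le>m. a k * matrix_power A k $ i $ j) = 0" and "\<exists>k\<le>m. a k \<noteq> 0"
  shows "card {c. is_eigenvalue A c} \<le> m"
proof -
  define p where "p = (\<Sum>k\<le>m. monom (a k) k)"
  have coeff_p: "coeff p k = (if k \<le> m then a k else 0)" for k
    by (simp add: p_def coeff_sum)
  then have "p \<noteq> 0"
    using assms(2) by (metis coeff_0)
  have "degree p \<le> m"
    by (rule degree_le) (simp add: coeff_p)
  have "{c. is_eigenvalue A c} \<subseteq> {x. poly p x = 0}"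
    using eigenvalue_root_of_annihilating_polynomial[OF assms(1)]
    by (auto simp: p_def poly_sum poly_monom)
  then have "card {c. is_eigenvalue A c} \<le> card {x. poly p x = 0}"
    by (rule card_mono[OF poly_roots_finite[OF \<open>p \<noteq> 0\<close>]])
  also have "\<dots> \<le> degree p"
    by (rule card_poly_roots_bound[OF \<open>p \<noteq> 0\<close>])
  finally show ?thesis
    using \<open>degree p \<le> m\<close> by simp
qed

lemma vec_linear_relation_exists:
  fixes w :: "nat \<Rightarrow> 'a::field^'n::finite"
  assumes "\<And>k. k \<le> m \<Longrightarrow> w k \<in> U" and "vec.dim U \<le> m"
  shows "\<exists>a. (\<exists>k\<le>m. a k \<noteq> 0) \<and> (\<Sum>k\<le>m. a k *s w k) = 0"
proof (cases "inj_on w {..m}")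
  case False
  then obtain i j where ij: "i \<le> m" "j \<le> m" "i \<noteq> j" "w i = w j"
    unfolding inj_on_def by auto
  define a :: "nat \<Rightarrow> 'a" where "a k = (if k = i then 1 else if k = j then -1 else 0)" for k
  have "(\<Sum>k\<le>m. a k *s w k) = (\<Sum>k\<le>m. (if k = i then w i else 0) - (if k = j then w j else 0))"
    by (rule sum.cong) (use ij in \<open>auto simp: a_def\<close>)
  also have "\<dots> = 0"
    using ij by (simp add: sum_subtractf)
  finally show ?thesis
    using ij(1) by (intro exI[of _ a]) (auto simp: a_def)
next
  case True
  let ?S = "w ` {..m}"
  have "\<not> vec.independent ?S"
  proof
    assume "vec.independent ?S"
    then have "card ?S \<le> vec.dim U"
      using assms(1) vec.independent_card_le_dim[of ?S U] by blast
    then show False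
      using assms(2) card_image[OF True] by simp
  qed
  then obtain u where u: "\<exists>v\<in>?S. u v \<noteq> 0" "(\<Sum>v\<in>?S. u v *s v) = 0"
    using vec.dependent_finite[of ?S] by auto
  have "(\<Sum>k\<le>m. u (w k) *s w k) = (\<Sum>v\<in>?S. u v *s v)"
    using sum.reindex[OF True, of "\<lambda>v. u v *s v"] by simp
  then show ?thesis
    using u by (intro exI[of _ "u \<circ> w"]) auto
qed

section \<open>The orbital algebra of the special unit-digraph\<close>

lemma bij_matrix_affine:
  fixes P Q :: "'a::field^'n::finite^'n"
  assumes "det P \<noteq> 0" "det Q \<noteq> 0"
  shows "bij (\<lambda>C. A + P ** (C - A') ** Q)"
proof -
  obtain P' where "P ** P' = mat 1" "P' ** P = mat 1"
    using inverse_matrix_exists[OF assms(1)] by blast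
  obtain Q' where "Q ** Q' = mat 1" "Q' ** Q = mat 1"
    using inverse_matrix_exists[OF assms(2)] by blast
  show ?thesis
  proof (rule bij_betw_byWitness[where f'="\<lambda>C. A' + P' ** (C - A) ** Q'"])
    show "\<forall>C\<in>UNIV. A' + P' ** (A + P ** (C - A') ** Q - A) ** Q' = C"
      using \<open>P' ** P = mat 1\<close> \<open>Q ** Q' = mat 1\<close> by (simp add: matrix_mul_sandwich_cancel)
    show "\<forall>C\<in>UNIV. A + P ** (A' + P' ** (C - A) ** Q' - A') ** Q = C"
      using \<open>P ** P' = mat 1\<close> \<open>Q' ** Q = mat 1\<close> by (simp add: matrix_mul_sandwich_cancel)
  qed auto
qed

text \<open>The matrices constant on the orbitals of the automorphisms C \<mapsto> P C Q + T
  (P, Q \<in> SL_n) of the digraph.\<close>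
definition SL_orbital :: "complex^('a::{finite,field}^'n::finite^'n)^('a^'n^'n) \<Rightarrow> bool" where
  "SL_orbital X \<longleftrightarrow> (\<forall>A B A' B'. SL_equiv (B - A) (B' - A') \<longrightarrow> X $ A $ B = X $ A' $ B')"

lemma SL_orbital_mat_1: "SL_orbital (mat 1)"
  unfolding SL_orbital_def
proof (intro allI impI)
  fix A B A' B' :: "'a::{finite,field}^'n::finite^'n"
  assume "SL_equiv (B - A) (B' - A')"
  then have "A = B \<longleftrightarrow> A' = B'"
    using SL_equiv_zero_iff by fastforce
  then show "(mat 1 :: complex^('a^'n^'n)^('a^'n^'n)) $ A $ B = mat 1 $ A' $ B'"
    by (simp add: mat_def)
qed

lemma SL_orbital_sud_adj_mult:
  fixes X :: "complex^('a::{finite,field}^'n::finite^'n)^('a^'n^'n)"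
  assumes "SL_orbital X"
  shows "SL_orbital (sud_adj ** X)"
  unfolding SL_orbital_def
proof (intro allI impI)
  fix A B A' B' :: "'a^'n^'n"
  assume "SL_equiv (B - A) (B' - A')"
  then obtain P Q where "P \<in> SL" "Q \<in> SL" and B: "B - A = P ** (B' - A') ** Q"
    unfolding SL_equiv_def by blast
  define \<phi> where "\<phi> C = A + P ** (C - A') ** Q" for C
  have "bij \<phi>"
    unfolding \<phi>_def using \<open>P \<in> SL\<close> \<open>Q \<in> SL\<close> by (intro bij_matrix_affine) (simp_all add: SL_def)
  have "(sud_adj ** X) $ A $ B = (\<Sum>C\<in>UNIV. sud_adj $ A $ C * X $ C $ B)"
    by (simp add: matrix_matrix_mult_def)
  also have "\<dots> = (\<Sum>C\<in>UNIV. sud_adj $ A $ \<phi> C * X $ \<phi> C $ B)"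
    by (rule sum.reindex_bij_betw[OF \<open>bij \<phi>\<close>, symmetric])
  also have "\<dots> = (\<Sum>C\<in>UNIV. sud_adj $ A' $ C * X $ C $ B')"
  proof (rule sum.cong[OF refl])
    fix C
    have "det (\<phi> C - A) = det (C - A')"
      using \<open>P \<in> SL\<close> \<open>Q \<in> SL\<close> by (simp add: \<phi>_def det_mul SL_def)
    moreover have "B - \<phi> C = P ** (B' - C) ** Q"
      using B by (simp add: \<phi>_def matrix_diff_ldistrib matrix_diff_rdistrib algebra_simps)
    then have "SL_equiv (B - \<phi> C) (B' - C)"
      unfolding SL_equiv_def using \<open>P \<in> SL\<close> \<open>Q \<in> SL\<close> by blast
    then have "X $ \<phi> C $ B = X $ C $ B'"
      using assms unfolding SL_orbital_def by blast
    ultimately show "sud_adj $ A $ \<phi> C * X $ \<phi> C $ B = sud_adj $ A' $ C * X $ C $ B'"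
      by (simp add: sud_adj_def sud_edges_def)
  qed
  also have "\<dots> = (sud_adj ** X) $ A' $ B'"
    by (simp add: matrix_matrix_mult_def)
  finally show "(sud_adj ** X) $ A $ B = (sud_adj ** X) $ A' $ B'" .
qed

lemma SL_orbital_matrix_power_sud_adj: "SL_orbital (matrix_power sud_adj k)"
  by (induction k) (simp_all add: SL_orbital_mat_1 SL_orbital_sud_adj_mult)

text \<open>Coordinates of an orbital matrix: its entries at the class representatives (the index
  Inr 0 is unused).\<close>
definition orbital_coords :: "complex^('a::{finite,field}^'n::finite^'n)^('a^'n^'n) \<Rightarrow> complex^('n + 'a)" where
  "orbital_coords X = (\<chi> j. case j of
      Inl i \<Rightarrow> X $ 0 $ partial_id (idx i)
    | Inr c \<Rightarrow> if c = 0 then 0 else X $ 0 $ corner_diag c)"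

lemma SL_orbital_entry_is_coord:
  fixes A B :: "'a::{finite,field}^'n::finite^'n"
  obtains j where "\<And>X. SL_orbital X \<Longrightarrow> X $ A $ B = orbital_coords X $ j"
proof -
  consider r where "r < CARD('n)" "SL_equiv (B - A) (partial_id r - 0)"
    | c where "c \<noteq> 0" "SL_equiv (B - A) (corner_diag c - 0)"
    using SL_equiv_representative[of "B - A"] by auto
  then show thesis
  proof cases
    case (1 r)
    then obtain i :: 'n where "idx i = r"
      using ex_idx_eq by blast
    then show thesis
      using 1 by (intro that[of "Inl i"]) (auto simp: SL_orbital_def orbital_coords_def)
  next
    case (2 c)
    then show thesis
      by (intro that[of "Inr c"]) (auto simp: SL_orbital_def orbital_coords_def)
  qed
qed

lemma dim_orbital_coords_space:
  "vec.dim {v :: complex^('n::finite + 'a::{finite,field}). v $ Inr 0 = 0} = CARD('n) + CARD('a) - 1"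
proof -
  have "{v :: complex^('n + 'a). v $ Inr 0 = 0} = {v. \<forall>j. j \<notin> UNIV - {Inr 0} \<longrightarrow> v $ j = 0}"
    by auto
  then show ?thesis
    using dim_substandard_cart[of "UNIV - {Inr 0 :: 'n + 'a}", where 'a=complex]
    by (simp add: card_Diff_singleton)
qed

lemma sud_adj_annihilating_polynomial:
  "\<exists>a. (\<exists>k\<le>CARD('n) + CARD('a) - 1. a k \<noteq> 0) \<and>
     (\<forall>A B. (\<Sum>k\<le>CARD('n) + CARD('a) - 1.
       a k * matrix_power (sud_adj :: complex^('a::{finite,field}^'n::finite^'n)^('a^'n^'n)) k $ A $ B) = 0)"
proof -
  let ?m = "CARD('n) + CARD('a) - 1"
  let ?X = "matrix_power (sud_adj :: complex^('a^'n^'n)^('a^'n^'n))"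
  obtain a where a: "\<exists>k\<le>?m. a k \<noteq> 0" "(\<Sum>k\<le>?m. a k *s orbital_coords (?X k)) = 0"
    using vec_linear_relation_exists[of ?m "\<lambda>k. orbital_coords (?X k)"
        "{v. v $ Inr 0 = 0}"] dim_orbital_coords_space[where 'n='n and 'a='a]
    by (auto simp: orbital_coords_def)
  have "(\<Sum>k\<le>?m. a k * ?X k $ A $ B) = 0" for A B
  proof -
    obtain j where j: "\<And>X. SL_orbital X \<Longrightarrow> X $ A $ B = orbital_coords X $ j"
      using SL_orbital_entry_is_coord[of A B] by auto
    have "(\<Sum>k\<le>?m. a k * ?X k $ A $ B) = (\<Sum>k\<le>?m. a k *s orbital_coords (?X k)) $ j"
      by (simp add: j SL_orbital_matrix_power_sud_adj)
    also have "\<dots> = 0"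
      using a(2) by simp
    finally show ?thesis .
  qed
  then show ?thesis
    using a(1) by blast
qed

theorem corollary3p11:
  assumes "CARD('n::finite) \<ge> 2"
  shows "sud_strongly_connected TYPE('a::{finite,field}) TYPE('n)
       \<and> sud_diameter TYPE('a) TYPE('n) = 2
       \<and> ((uminus ` (SL :: ('a^'n^'n) set) = SL) \<longleftrightarrow> (even CARD('n) \<or> CHAR('a) = 2))
       \<and> card {c. is_eigenvalue (sud_adj :: complex ^ ('a^'n^'n) ^ ('a^'n^'n)) c}
           \<le> CARD('n) + CARD('a) - 1"
proof -
  obtain a where "\<exists>k\<le>CARD('n) + CARD('a) - 1. a k \<noteq> 0"
    "\<And>A B. (\<Sum>k\<le>CARD('n) + CARD('a) - 1.
      a k * matrix_power (sud_adj :: complex^('a^'n^'n)^('a^'n^'n)) k $ A $ B) = 0"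
    using sud_adj_annihilating_polynomial by blast
  then have "card {c. is_eigenvalue (sud_adj :: complex^('a^'n^'n)^('a^'n^'n)) c}
      \<le> CARD('n) + CARD('a) - 1"
    by (intro card_eigenvalues_le_annihilator_degree)
  then show ?thesis
    using sud_strongly_connected[OF assms] sud_diameter_eq_2[OF assms] uminus_SL_eq_SL_iff
    by simp
qed

end
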